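(* Let $k\geq1$, $n=3k+1\geq4$, and $$F_n=\sum_{i=0}^{k}x_{3i}x_{3i+1}^2+\sum_{i=1}^{k}x_{3i-2}x_{3i-1}x_{3i+1}\in\mathbb C[x_0,\dots,x_n].$$ Then $F_n$ has minimal border rank, i.e. $\underline{\mathbf r}(F_n)=n+1$.
   Context: For a nonzero form $F$ of degree $d$ in $x_0,\dots,x_n$, the border rank $\underline{\mathbf r}(F)$ is the least $r$ with $[F]\in\sigma_r(X)$, where $X=\nu_d(\mathbb P^n)$ is the Veronese variety of $d$-th powers $[L^d]$ of linear forms and $\sigma_r(X)$ is its $r$-th secant variety (closure of the union of the spans of $r$ points of $X$). *)

theory Defs
  imports Complex_Main "HOL-Library.Poly_Mapping"
begin

text \<open>Complex polynomials in variables indexed by the type \<open>'v\<close>: finitely supported maps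
  from exponent vectors to coefficients, with the convolution product of \<open>Poly_Mapping\<close>.\<close>

type_synonym 'v cpoly = "('v \<Rightarrow>\<^sub>0 nat) \<Rightarrow>\<^sub>0 complex"

definition const :: "complex \<Rightarrow> 'v cpoly" where
  "const c = Poly_Mapping.single 0 c"

definition var :: "'v \<Rightarrow> 'v cpoly" where
  "var i = Poly_Mapping.single (Poly_Mapping.single i 1) 1"

definition mon_degree :: "('v \<Rightarrow>\<^sub>0 nat) \<Rightarrow> nat" where
  "mon_degree m = (\<Sum>i\<in>Poly_Mapping.keys m. Poly_Mapping.lookup m i)"

definition homogeneous :: "nat \<Rightarrow> 'v cpoly \<Rightarrow> bool" where
  "homogeneous d P \<longleftrightarrow> (\<forall>m\<in>Poly_Mapping.keys P. mon_degree m = d)"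

definition eval_poly :: "('v \<Rightarrow> complex) \<Rightarrow> 'v cpoly \<Rightarrow> complex" where
  "eval_poly a P = (\<Sum>m\<in>Poly_Mapping.keys P.
     Poly_Mapping.lookup P m * (\<Prod>i\<in>Poly_Mapping.keys m. a i ^ Poly_Mapping.lookup m i))"

text \<open>Forms of degree \<open>d\<close> in \<open>x\<^sub>0, \<dots>, x\<^sub>n\<close>, including \<open>0\<close>.\<close>

definition forms :: "nat \<Rightarrow> nat \<Rightarrow> nat cpoly set" where
  "forms n d = {F. homogeneous d F \<and> (\<forall>m\<in>Poly_Mapping.keys F. Poly_Mapping.keys m \<subseteq> {..n})}"

text \<open>A point \<open>[F]\<close> of a projective space of forms is the set of nonzero scalar multiples of a
  nonzero representative \<open>F\<close>.\<close>

definition proj_class :: "nat cpoly \<Rightarrow> nat cpoly set" where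
  "proj_class F = {const c * F | c. c \<noteq> 0}"

text \<open>The homogeneous coordinates on the projective space of forms of degree \<open>d\<close> are the
  coefficients, so the defining equations are polynomials whose variables are indexed by monomials,
  evaluated at the coefficient function of \<open>F\<close>. Variables indexed by monomials that do not
  occur in \<^term>\<open>forms n d\<close> evaluate to \<open>0\<close> and do not change the closed sets.\<close>

definition zariski_closed :: "nat \<Rightarrow> nat \<Rightarrow> nat cpoly set set \<Rightarrow> bool" where
  "zariski_closed n d Z \<longleftrightarrow>
     (\<exists>E :: (nat \<Rightarrow>\<^sub>0 nat) cpoly set.
        (\<forall>P\<in>E. \<exists>e. homogeneous e P) \<and>
        Z = {proj_class F | F. F \<in> forms n d \<and> F \<noteq> 0 \<and>
                (\<forall>P\<in>E. eval_poly (Poly_Mapping.lookup F) P = 0)})"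

definition veronese :: "nat \<Rightarrow> nat \<Rightarrow> nat cpoly set set" where
  "veronese n d = {proj_class (L ^ d) | L. L \<in> forms n 1 \<and> L \<noteq> 0}"

text \<open>The projective linear span of the points \<open>p 0, \<dots>, p (r - 1)\<close>.\<close>

definition proj_span :: "nat \<Rightarrow> (nat \<Rightarrow> nat cpoly set) \<Rightarrow> nat cpoly set set" where
  "proj_span r p = {proj_class (\<Sum>i<r. const (a i) * G i) | a G.
     (\<forall>i<r. G i \<in> p i) \<and> (\<Sum>i<r. const (a i) * G i) \<noteq> 0}"

definition secant_variety :: "nat \<Rightarrow> nat \<Rightarrow> nat \<Rightarrow> nat cpoly set set" where
  "secant_variety n d r =
     zariski_closed n d hull (\<Union>p\<in>{p. \<forall>i<r. p i \<in> veronese n d}. proj_span r p)"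

text \<open>Meaningful for \<open>0 \<noteq> F \<in> forms n d\<close>.\<close>

definition border_rank :: "nat \<Rightarrow> nat \<Rightarrow> nat cpoly \<Rightarrow> nat" where
  "border_rank n d F = (LEAST r. proj_class F \<in> secant_variety n d r)"

text \<open>The cubic \<open>F\<^sub>n\<close> for \<open>n = 3 * k + 1\<close>. In the second sum \<open>i \<ge> 1\<close>, so the subtractions
  are not truncated.\<close>

definition chain_cubic :: "nat \<Rightarrow> nat cpoly" where
  "chain_cubic k =
     (\<Sum>i=0..k. var (3 * i) * var (3 * i + 1) ^ 2) +
     (\<Sum>i=1..k. var (3 * i - 2) * var (3 * i - 1) * var (3 * i + 1))"

end

theory Submission
  imports Defs "HOL-Library.Real_Mod" "Jordan_Normal_Form.Determinant"
begin

text \<open>Write \<open>y\<^sub>i = x\<^bsub>3i+1\<^esub>\<close>, \<open>u\<^bsub>2i\<^esub> = x\<^bsub>3i\<^esub>\<close> and \<open>u\<^bsub>2i+1\<^esub> = x\<^bsub>3i+2\<^esub> / 2\<close>, so that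
  the cubic is the sum of \<open>y\<^sub>a y\<^sub>b u\<^bsub>a+b\<^esub>\<close> over all \<open>a, b \<le> k\<close> with \<open>\<bar>a - b\<bar> \<le> 1\<close>.

  Upper bound: let \<open>\<omega>\<close> be a primitive root of unity of order \<open>N = 3k + 2\<close> and let
  \<open>V\<^sub>j\<close> be the sum of the \<open>\<omega>\<^bsup>ja\<^esup> y\<^sub>a\<close>, a point of a rational normal curve of degree \<open>k\<close>.
  The cubes \<open>V\<^sub>j\<^sup>3\<close> lie in a space of dimension \<open>3k + 1\<close> and satisfy the relation with
  coefficients \<open>\<omega>\<^sup>j\<close>, so the combination of the \<open>(V\<^sub>j + t W\<^sub>j)\<^sup>3\<close> with coefficients
  \<open>\<omega>\<^sup>j / (3t)\<close> tends to the sum of the \<open>\<omega>\<^sup>j V\<^sub>j\<^sup>2 W\<^sub>j\<close> as \<open>t \<longrightarrow> 0\<close>. Suitable \<open>W\<^sub>j\<close> make this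
  the sum of \<open>y\<^sub>a y\<^sub>b u\<^bsub>a+b\<^esub>\<close> over all \<open>a, b \<le> k\<close>. Rescaling \<open>y\<^sub>a\<close> by \<open>\<epsilon>\<^bsup>a*a\<^esup>\<close> and
  \<open>u\<^sub>m\<close> by \<open>\<epsilon>\<^bsup>-\<lceil>m*m/2\<rceil>\<^esup>\<close> and letting \<open>\<epsilon> \<longrightarrow> 0\<close> leaves the terms with \<open>\<bar>a - b\<bar> \<le> 1\<close>.

  Lower bound: a maximal minor of the catalecticant matrix vanishes on sums of \<open>n\<close> cubes,
  and there is one that is diagonal with nonzero diagonal entries at the cubic.\<close>

subsection \<open>Polynomials and forms\<close>

lemma const_0 [simp]: "const 0 = 0"
  by (simp add: const_def)

lemma const_1 [simp]: "const 1 = 1"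
  by (simp add: const_def)

lemma const_mult: "const (a * b) = const a * const b"
  by (simp add: const_def mult_single)

lemma const_add: "const (a + b) = const a + const b"
  by (simp add: const_def single_add)

lemma const_sum: "const (sum f A) = (\<Sum>x\<in>A. const (f x))"
  by (induction A rule: infinite_finite_induct) (simp_all add: const_add)

lemma const_power: "const (a ^ e) = const a ^ e"
  by (induction e) (simp_all add: const_mult)

lemma const_mult_const: "const a * (const b * P) = const (a * b) * P"
  by (simp add: const_mult mult.assoc)

lemma lookup_const_mult [simp]:
  "Poly_Mapping.lookup (const c * P) m = c * Poly_Mapping.lookup P m"
proof -
  have "const c * P = Poly_Mapping.map ((*) c) P"
    by (simp add: const_def mult_map_scale_conv_mult)
  then show ?thesis
    by (simp add: Poly_Mapping.map.rep_eq when_def)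
qed

lemma poly_mapping_sum_single:
  "P = (\<Sum>m\<in>Poly_Mapping.keys P. Poly_Mapping.single m (Poly_Mapping.lookup P m))"
  by (rule poly_mapping_eqI)
    (auto simp: lookup_sum lookup_single when_def in_keys_iff sum.delta)

section \<open>Evaluation of monomials and polynomials\<close>

definition mon_val :: "('v \<Rightarrow> complex) \<Rightarrow> ('v \<Rightarrow>\<^sub>0 nat) \<Rightarrow> complex" where
  "mon_val a m = (\<Prod>i\<in>Poly_Mapping.keys m. a i ^ Poly_Mapping.lookup m i)"

text \<open>The key sets of \<open>m\<close>, \<open>m'\<close> and \<open>m + m'\<close> differ; a
  common finite index set lets their products be compared factor by factor. Sums and degrees are
  treated the same way.\<close>

lemma mon_val_superset:
  "finite S \<Longrightarrow> Poly_Mapping.keys m \<subseteq> S \<Longrightarrow>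
    mon_val a m = (\<Prod>i\<in>S. a i ^ Poly_Mapping.lookup m i)"
  unfolding mon_val_def by (rule prod.mono_neutral_left) (auto simp: in_keys_iff)

lemma mon_val_add: "mon_val a (m + m') = mon_val a m * mon_val a m'"
proof -
  let ?S = "Poly_Mapping.keys m \<union> Poly_Mapping.keys m'"
  have "mon_val a (m + m') = (\<Prod>i\<in>?S. a i ^ Poly_Mapping.lookup (m + m') i)"
    by (rule mon_val_superset) (use keys_add[of m m'] in auto)
  also have "\<dots> = mon_val a m * mon_val a m'"
    by (simp add: lookup_add power_add prod.distrib mon_val_superset[of ?S])
  finally show ?thesis .
qed

lemma mon_val_0 [simp]: "mon_val a 0 = 1"
  by (simp add: mon_val_def)

lemma mon_val_single [simp]: "mon_val a (Poly_Mapping.single i e) = a i ^ e"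
  by (simp add: mon_val_def)

lemma mon_val_scale: "mon_val (\<lambda>i. c * a i) m = c ^ mon_degree m * mon_val a m"
  by (simp add: mon_val_def mon_degree_def power_mult_distrib prod.distrib power_sum)

lemma eval_poly_superset:
  "finite S \<Longrightarrow> Poly_Mapping.keys P \<subseteq> S \<Longrightarrow>
    eval_poly a P = (\<Sum>m\<in>S. Poly_Mapping.lookup P m * mon_val a m)"
  unfolding eval_poly_def mon_val_def[symmetric]
  by (rule sum.mono_neutral_left) (auto simp: in_keys_iff)

lemma eval_poly_0 [simp]: "eval_poly a 0 = 0"
  by (simp add: eval_poly_def)

lemma eval_poly_single: "eval_poly a (Poly_Mapping.single m c) = c * mon_val a m"
  by (simp add: eval_poly_def mon_val_def)

lemma eval_poly_const [simp]: "eval_poly a (const c) = c"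
  by (simp add: const_def eval_poly_single)

lemma eval_poly_1 [simp]: "eval_poly a 1 = 1"
  using eval_poly_const[of a 1] by simp

lemma eval_poly_var [simp]: "eval_poly a (var i) = a i"
  by (simp add: var_def eval_poly_single)

lemma eval_poly_add: "eval_poly a (P + Q) = eval_poly a P + eval_poly a Q"
proof -
  let ?S = "Poly_Mapping.keys P \<union> Poly_Mapping.keys Q"
  have "eval_poly a (P + Q) = (\<Sum>m\<in>?S. Poly_Mapping.lookup (P + Q) m * mon_val a m)"
    by (rule eval_poly_superset) (use keys_add[of P Q] in auto)
  also have "\<dots> = eval_poly a P + eval_poly a Q"
    by (simp add: lookup_add distrib_right sum.distrib eval_poly_superset[of ?S])
  finally show ?thesis .
qed

lemma eval_poly_sum: "eval_poly a (sum f A) = (\<Sum>x\<in>A. eval_poly a (f x))"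
  by (induction A rule: infinite_finite_induct) (simp_all add: eval_poly_add)

lemma eval_poly_mult: "eval_poly a (P * Q) = eval_poly a P * eval_poly a Q"
proof -
  let ?s = "\<lambda>P m. Poly_Mapping.single m (Poly_Mapping.lookup P m)"
  have "P * Q = (\<Sum>m\<in>Poly_Mapping.keys P. ?s P m) * (\<Sum>m'\<in>Poly_Mapping.keys Q. ?s Q m')"
    by (rule arg_cong2[OF poly_mapping_sum_single poly_mapping_sum_single])
  also have "eval_poly a \<dots> = (\<Sum>m\<in>Poly_Mapping.keys P. \<Sum>m'\<in>Poly_Mapping.keys Q.
      (Poly_Mapping.lookup P m * mon_val a m) * (Poly_Mapping.lookup Q m' * mon_val a m'))"
    unfolding sum_product eval_poly_sum mult_single eval_poly_single mon_val_add
    by (intro sum.cong refl) (simp only: mult_ac)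
  also have "\<dots> = eval_poly a P * eval_poly a Q"
    unfolding sum_product[symmetric] by (simp only: eval_poly_def mon_val_def)
  finally show ?thesis .
qed

lemma eval_poly_prod: "eval_poly a (prod f A) = (\<Prod>x\<in>A. eval_poly a (f x))"
  by (induction A rule: infinite_finite_induct) (simp_all add: eval_poly_mult)

text \<open>Every monomial contributes the same factor \<open>c ^ e\<close>; hence a homogeneous
  equation can be tested on any representative of a projective point.\<close>

lemma eval_poly_scale:
  assumes "homogeneous e P"
  shows "eval_poly (\<lambda>i. c * a i) P = c ^ e * eval_poly a P"
  using assms
  by (simp add: homogeneous_def eval_poly_superset[of "Poly_Mapping.keys P"] mon_val_scale
      sum_distrib_left mult_ac)

text \<open>Polynomials are continuous, so equations pass to limits.\<close>

lemma tendsto_eval_poly: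
  assumes "\<And>i. ((\<lambda>t. a t i) \<longlongrightarrow> b i) \<F>"
  shows "((\<lambda>t. eval_poly (a t) P) \<longlongrightarrow> eval_poly b P) \<F>"
  unfolding eval_poly_def by (intro tendsto_intros assms)

section \<open>Degrees and homogeneity\<close>

lemma mon_degree_superset:
  "finite S \<Longrightarrow> Poly_Mapping.keys m \<subseteq> S \<Longrightarrow> mon_degree m = (\<Sum>i\<in>S. Poly_Mapping.lookup m i)"
  unfolding mon_degree_def by (rule sum.mono_neutral_left) (auto simp: in_keys_iff)

lemma mon_degree_add: "mon_degree (m + m') = mon_degree m + mon_degree m'"
proof -
  let ?S = "Poly_Mapping.keys m \<union> Poly_Mapping.keys m'"
  have "mon_degree (m + m') = (\<Sum>i\<in>?S. Poly_Mapping.lookup (m + m') i)"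
    by (rule mon_degree_superset) (use keys_add[of m m'] in auto)
  also have "\<dots> = mon_degree m + mon_degree m'"
    by (simp add: lookup_add sum.distrib mon_degree_superset[of ?S])
  finally show ?thesis .
qed

lemma homogeneous_0 [simp]: "homogeneous d 0"
  by (simp add: homogeneous_def)

lemma homogeneous_add: "homogeneous d P \<Longrightarrow> homogeneous d Q \<Longrightarrow> homogeneous d (P + Q)"
  using keys_add[of P Q] by (auto simp: homogeneous_def)

lemma homogeneous_mult: "homogeneous d P \<Longrightarrow> homogeneous e Q \<Longrightarrow> homogeneous (d + e) (P * Q)"
  using keys_mult[of P Q] by (force simp: homogeneous_def mon_degree_add)

lemma homogeneous_const [simp]: "homogeneous 0 (const c)"
  by (simp add: homogeneous_def const_def mon_degree_def)

lemma homogeneous_var [simp]: "homogeneous 1 (var i)"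
  by (simp add: homogeneous_def var_def mon_degree_def)

lemma homogeneous_sum: "(\<And>x. x \<in> A \<Longrightarrow> homogeneous d (f x)) \<Longrightarrow> homogeneous d (sum f A)"
  by (induction A rule: infinite_finite_induct) (simp_all add: homogeneous_add)

lemma homogeneous_prod:
  "finite A \<Longrightarrow> (\<And>x. x \<in> A \<Longrightarrow> homogeneous 1 (f x)) \<Longrightarrow> homogeneous (card A) (prod f A)"
proof (induction A rule: finite_induct)
  case empty
  show ?case using homogeneous_const[of 1] by simp
next
  case (insert x A)
  then show ?case using homogeneous_mult[of 1 "f x" "card A" "prod f A"] by simp
qed

section \<open>Closure properties of the spaces of forms\<close>

lemma forms_0 [simp]: "0 \<in> forms n d"
  by (simp add: forms_def)

lemma forms_add: "P \<in> forms n d \<Longrightarrow> Q \<in> forms n d \<Longrightarrow> P + Q \<in> forms n d"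
  using keys_add[of P Q] by (auto simp: forms_def homogeneous_add)

lemma forms_sum: "(\<And>x. x \<in> A \<Longrightarrow> f x \<in> forms n d) \<Longrightarrow> sum f A \<in> forms n d"
  by (induction A rule: infinite_finite_induct) (simp_all add: forms_add)

lemma forms_mult:
  assumes "P \<in> forms n d" "Q \<in> forms n e"
  shows "P * Q \<in> forms n (d + e)"
  unfolding forms_def mem_Collect_eq
proof (intro conjI ballI)
  show "homogeneous (d + e) (P * Q)"
    using assms by (simp add: forms_def homogeneous_mult)
  fix m assume "m \<in> Poly_Mapping.keys (P * Q)"
  then obtain a b where "m = a + b" "a \<in> Poly_Mapping.keys P" "b \<in> Poly_Mapping.keys Q"
    using keys_mult[of P Q] by auto
  then have "Poly_Mapping.keys a \<subseteq> {..n}" "Poly_Mapping.keys b \<subseteq> {..n}"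
    using assms by (auto simp: forms_def)
  with keys_add[of a b] show "Poly_Mapping.keys m \<subseteq> {..n}"
    unfolding \<open>m = a + b\<close> by blast
qed

lemma forms_const: "const c \<in> forms n 0"
  using homogeneous_const[of c] by (auto simp: forms_def const_def)

lemma forms_const_mult: "P \<in> forms n d \<Longrightarrow> const c * P \<in> forms n d"
  using forms_mult[OF forms_const, of P n d c] by simp

lemma forms_var: "i \<le> n \<Longrightarrow> var i \<in> forms n 1"
  using homogeneous_var[of i] by (simp add: forms_def var_def)

lemma forms_power: "L \<in> forms n 1 \<Longrightarrow> L ^ d \<in> forms n d"
proof (induction d)
  case 0
  show ?case by (simp add: forms_def homogeneous_def mon_degree_def)
next
  case (Suc d)
  then show ?case using forms_mult[of L n 1 "L ^ d" d] by simp
qed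

lemma var_neq_0 [simp]: "var i \<noteq> 0"
  using eval_poly_var[of "\<lambda>_. 1" i] by (auto simp del: eval_poly_var)

lemma single_1_eq_iff [simp]:
  "Poly_Mapping.single x (Suc 0) = Poly_Mapping.single y (Suc 0) \<longleftrightarrow> x = y"
  by (metis lookup_single_eq lookup_single_not_eq nat.distinct(1))

text \<open>Exponents are natural numbers, so degree one leaves a single exponent equal to 1: every
  monomial of \<open>L\<close> is a variable.\<close>

lemma linear_form_expand:
  assumes "L \<in> forms n 1"
  obtains l where "L = (\<Sum>v\<le>n. const (l v) * var v)"
proof
  let ?x = "\<lambda>v. Poly_Mapping.single v (1::nat)"
  have *: "\<exists>v\<le>n. m = ?x v" if "m \<in> Poly_Mapping.keys L" for m
  proof -
    from that assms have deg: "(\<Sum>i\<in>Poly_Mapping.keys m. Poly_Mapping.lookup m i) = 1"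
      and sub: "Poly_Mapping.keys m \<subseteq> {..n}"
      by (auto simp: forms_def homogeneous_def mon_degree_def)
    from deg obtain v where v: "v \<in> Poly_Mapping.keys m" "Poly_Mapping.lookup m v = 1"
      and "\<forall>w\<in>Poly_Mapping.keys m. w \<noteq> v \<longrightarrow> Poly_Mapping.lookup m w = 0"
      by (subst (asm) sum_eq_1_iff) auto
    then have "m = ?x v"
      by (intro poly_mapping_eqI) (metis in_keys_iff lookup_single_eq lookup_single_not_eq)
    with v sub show ?thesis by auto
  qed
  have "L = (\<Sum>m\<in>Poly_Mapping.keys L. Poly_Mapping.single m (Poly_Mapping.lookup L m))"
    by (rule poly_mapping_sum_single)
  also have "\<dots> = (\<Sum>m\<in>?x ` {..n}. Poly_Mapping.single m (Poly_Mapping.lookup L m))"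
    by (rule sum.mono_neutral_left) (use * in \<open>auto simp: in_keys_iff\<close>)
  also have "\<dots> = (\<Sum>v\<le>n. Poly_Mapping.single (?x v) (Poly_Mapping.lookup L (?x v)))"
    by (subst sum.reindex) (simp_all add: inj_on_def)
  also have "\<dots> = (\<Sum>v\<le>n. const (Poly_Mapping.lookup L (?x v)) * var v)"
    by (simp add: const_def var_def mult_single)
  finally show "L = (\<Sum>v\<le>n. const (Poly_Mapping.lookup L (?x v)) * var v)" .
qed

subsection \<open>Limits of points on secants\<close>

lemma proj_class_refl: "F \<in> proj_class F"
  by (auto simp: proj_class_def intro!: exI[of _ 1])

text \<open>Membership may be witnessed by another representative \<open>F\<close>; then
  \<open>G\<close> is a multiple of \<open>F\<close> and homogeneity carries the equation
  over.\<close>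

lemma vanishes_on_proj_class:
  assumes "\<forall>P\<in>E. \<exists>e. homogeneous e P"
    and "proj_class G \<in> {proj_class F | F. F \<in> forms n d \<and> F \<noteq> 0 \<and>
                (\<forall>P\<in>E. eval_poly (Poly_Mapping.lookup F) P = 0)}"
    and "P \<in> E"
  shows "eval_poly (Poly_Mapping.lookup G) P = 0"
proof -
  from assms(2) obtain F where F: "proj_class G = proj_class F"
    "\<forall>P\<in>E. eval_poly (Poly_Mapping.lookup F) P = 0" by auto
  with proj_class_refl[of G] obtain c where "G = const c * F"
    unfolding proj_class_def by blast
  then have "Poly_Mapping.lookup G = (\<lambda>m. c * Poly_Mapping.lookup F m)"
    by auto
  moreover obtain e where "homogeneous e P"
    using assms by blast
  ultimately show ?thesis
    using F assms(3) by (simp add: eval_poly_scale)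
qed

lemma sum_powers_in_secant_variety:
  assumes L: "\<And>j. j < r \<Longrightarrow> L j \<in> forms n 1" and "d > 0"
    and "(\<Sum>j<r. const (a j) * L j ^ d) \<noteq> 0"
  shows "proj_class (\<Sum>j<r. const (a j) * L j ^ d) \<in> secant_variety n d r"
proof -
  \<comment> \<open>The zero form gives no Veronese point. Such summands become multiples of
    \<open>var 0 ^ d\<close> with coefficient 0, and \<open>d > 0\<close> keeps the sum
    unchanged.\<close>
  define L' where "L' j = (if L j = 0 then var 0 else L j)" for j
  define a' where "a' j = (if L j = 0 then 0 else a j)" for j
  define p where "p j = proj_class (L' j ^ d)" for j
  have *: "(\<Sum>j<r. const (a j) * L j ^ d) = (\<Sum>j<r. const (a' j) * L' j ^ d)"
    using \<open>d > 0\<close> by (intro sum.cong) (auto simp: a'_def L'_def)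
  have "p j \<in> veronese n d" if "j < r" for j
    using L[OF that] forms_var[of 0 n] by (auto simp: p_def veronese_def L'_def)
  moreover have "proj_class (\<Sum>j<r. const (a j) * L j ^ d) \<in> proj_span r p"
    using assms(3) unfolding * proj_span_def mem_Collect_eq
    by (intro exI[of _ a'] exI[of _ "\<lambda>j. L' j ^ d"]) (simp add: p_def proj_class_refl)
  ultimately show ?thesis
    unfolding secant_variety_def by (intro subsetD[OF hull_subset]) blast
qed

text \<open>Zariski closed sets are closed under coefficientwise limits, since their equations are
  continuous. Some coefficient of \<open>F\<close> is nonzero, so \<open>G t\<close> is eventually
  nonzero and its class is a point.\<close>

lemma secant_variety_limit:
  assumes "F \<in> forms n d" "F \<noteq> 0" "\<F> \<noteq> bot"
    and lim: "\<And>m. ((\<lambda>t. Poly_Mapping.lookup (G t) m) \<longlongrightarrow> Poly_Mapping.lookup F m) \<F>"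
    and sec: "eventually (\<lambda>t. G t \<noteq> 0 \<longrightarrow> proj_class (G t) \<in> secant_variety n d r) \<F>"
  shows "proj_class F \<in> secant_variety n d r"
  unfolding secant_variety_def hull_def Inter_iff
proof (intro allI impI ballI, unfold mem_Collect_eq, elim conjE)
  fix Z :: "nat cpoly set set"
  let ?S = "\<Union>p\<in>{p. \<forall>i<r. p i \<in> veronese n d}. proj_span r p"
  assume Z: "zariski_closed n d Z" "?S \<subseteq> Z"
  from \<open>F \<noteq> 0\<close> obtain m where m: "Poly_Mapping.lookup F m \<noteq> 0"
    by (auto simp: poly_mapping_eq_iff fun_eq_iff)
  have "eventually (\<lambda>t. Poly_Mapping.lookup (G t) m \<noteq> 0) \<F>"
    using tendsto_imp_eventually_ne[OF lim m] .
  then have "eventually (\<lambda>t. proj_class (G t) \<in> secant_variety n d r) \<F>"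
    using sec by eventually_elim auto
  then have ev: "eventually (\<lambda>t. proj_class (G t) \<in> Z) \<F>"
    using hull_minimal[of ?S Z "zariski_closed n d"] Z
    by (auto simp: secant_variety_def elim!: eventually_mono)
  from Z(1) obtain E where E: "\<forall>P\<in>E. \<exists>e. homogeneous e P"
    "Z = {proj_class F | F. F \<in> forms n d \<and> F \<noteq> 0 \<and>
                (\<forall>P\<in>E. eval_poly (Poly_Mapping.lookup F) P = 0)}"
    unfolding zariski_closed_def by auto
  have "eval_poly (Poly_Mapping.lookup F) P = 0" if "P \<in> E" for P
  proof (rule tendsto_unique[OF \<open>\<F> \<noteq> bot\<close>])
    show "((\<lambda>t. eval_poly (Poly_Mapping.lookup (G t)) P) \<longlongrightarrow>
        eval_poly (Poly_Mapping.lookup F) P) \<F>"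
      by (rule tendsto_eval_poly) (rule lim)
    have "eventually (\<lambda>t. eval_poly (Poly_Mapping.lookup (G t)) P = 0) \<F>"
      using ev
    proof eventually_elim
      case (elim t)
      then show ?case
        unfolding E(2) by (rule vanishes_on_proj_class[OF E(1) _ that])
    qed
    then show "((\<lambda>t. eval_poly (Poly_Mapping.lookup (G t)) P) \<longlongrightarrow> 0) \<F>"
      by (rule tendsto_eventually)
  qed
  then show "proj_class F \<in> Z"
    using assms(1,2) unfolding E(2) by blast
qed

section \<open>Upper bound for the sum over all index pairs, by discrete Fourier sums\<close>

lemma root_of_unity_power_sum:
  assumes "N > 0"
  obtains \<omega> :: complex
    where "\<And>s. (\<Sum>j<N. \<omega> ^ (j * s)) = (if N dvd s then of_nat N else 0)"
proof
  define \<omega> where "\<omega> = cis (2 * pi / N)"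
  have 1: "\<omega> ^ N = 1"
    using assms by (simp add: \<omega>_def DeMoivre)
  fix s :: nat
  have *: "(\<Sum>j<N. \<omega> ^ (j * s)) = (\<Sum>j<N. (\<omega> ^ s) ^ j)"
    by (simp add: power_mult[symmetric] mult.commute)
  show "(\<Sum>j<N. \<omega> ^ (j * s)) = (if N dvd s then of_nat N else 0)"
  proof (cases "N dvd s")
    case True
    then obtain q where "s = N * q" by blast
    then have "\<omega> ^ s = 1" by (simp add: power_mult 1)
    with True show ?thesis unfolding * by simp
  next
    case False
    have "\<omega> ^ s \<noteq> 1"
    proof
      assume "\<omega> ^ s = 1"
      then have "cis (s * (2 * pi / N)) = 1" by (simp add: \<omega>_def DeMoivre)
      then obtain z :: int where "s * (2 * pi / N) = of_int z * (2 * pi)"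
        unfolding cis_eq_1_iff by blast
      then have "real s = of_int z * real N"
        using assms by (simp add: field_simps)
      then have "int s = z * int N"
        by (metis of_int_eq_iff of_int_mult of_int_of_nat_eq)
      then have "N dvd s"
        by (metis dvd_triv_right int_dvd_int_iff)
      with False show False by blast
    qed
    moreover have "(\<omega> ^ s) ^ N = 1"
      by (metis 1 power_mult mult.commute power_one)
    ultimately show ?thesis
      using False unfolding * by (simp add: geometric_sum)
  qed
qed

text \<open>Expanding and moving the sum over \<open>j\<close> innermost turns it into a scalar,
  which in the applications is a power sum of roots of unity. A one-element \<open>J\<close> expands
  a single product.\<close>

lemma const_trilinear_sum:
  "(\<Sum>j\<in>J. const (c j) * ((\<Sum>a\<in>A. const (f j a) * X a) *
      (\<Sum>b\<in>B. const (g j b) * Y b) * (\<Sum>e\<in>D. const (h j e) * Z e))) =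
   (\<Sum>a\<in>A. \<Sum>b\<in>B. \<Sum>e\<in>D.
      const (\<Sum>j\<in>J. c j * (f j a * g j b * h j e)) * (X a * Y b * Z e))"
proof -
  let ?T = "\<lambda>j a b e. const (c j * (f j a * g j b * h j e)) * (X a * Y b * Z e)"
  have "(\<Sum>j\<in>J. const (c j) * ((\<Sum>a\<in>A. const (f j a) * X a) *
      (\<Sum>b\<in>B. const (g j b) * Y b) * (\<Sum>e\<in>D. const (h j e) * Z e))) =
    (\<Sum>j\<in>J. \<Sum>a\<in>A. \<Sum>b\<in>B. \<Sum>e\<in>D. ?T j a b e)"
  proof (intro sum.cong refl)
    fix j
    have "(\<Sum>a\<in>A. const (f j a) * X a) * (\<Sum>b\<in>B. const (g j b) * Y b) *
        (\<Sum>e\<in>D. const (h j e) * Z e) =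
      (\<Sum>a\<in>A. const (f j a) * X a * ((\<Sum>b\<in>B. const (g j b) * Y b) *
        (\<Sum>e\<in>D. const (h j e) * Z e)))"
      unfolding mult.assoc[of "sum _ A"] by (rule sum_distrib_right)
    also have "\<dots> = (\<Sum>a\<in>A. \<Sum>b\<in>B. \<Sum>e\<in>D.
        const (f j a) * X a * (const (g j b) * Y b * (const (h j e) * Z e)))"
      by (subst sum_product) (simp only: sum_distrib_left)
    finally show "const (c j) * ((\<Sum>a\<in>A. const (f j a) * X a) *
        (\<Sum>b\<in>B. const (g j b) * Y b) * (\<Sum>e\<in>D. const (h j e) * Z e)) =
      (\<Sum>a\<in>A. \<Sum>b\<in>B. \<Sum>e\<in>D. ?T j a b e)"
      by (simp only: sum_distrib_left const_mult mult_ac)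
  qed
  also have "\<dots> = (\<Sum>a\<in>A. \<Sum>j\<in>J. \<Sum>b\<in>B. \<Sum>e\<in>D. ?T j a b e)"
    by (rule sum.swap)
  also have "\<dots> = (\<Sum>a\<in>A. \<Sum>b\<in>B. \<Sum>j\<in>J. \<Sum>e\<in>D. ?T j a b e)"
    by (intro sum.cong refl sum.swap)
  also have "\<dots> = (\<Sum>a\<in>A. \<Sum>b\<in>B. \<Sum>e\<in>D. \<Sum>j\<in>J. ?T j a b e)"
    by (intro sum.cong refl sum.swap)
  finally show ?thesis
    unfolding const_sum sum_distrib_right .
qed

lemma rational_normal_curve_in_secant_variety:
  assumes Y: "\<And>a. a \<le> k \<Longrightarrow> Y a \<in> forms n 1" and U: "\<And>m. m \<le> 2 * k \<Longrightarrow> U m \<in> forms n 1"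
  defines "N \<equiv> 3 * k + 2" and "H \<equiv> \<Sum>a\<le>k. \<Sum>b\<le>k. Y a * Y b * U (a + b)"
  assumes "H \<noteq> 0"
  shows "proj_class H \<in> secant_variety n 3 N"
proof -
  have "N > 0" by (simp add: N_def)
  then obtain \<omega> :: complex
    where \<omega>: "\<And>s. (\<Sum>j<N. \<omega> ^ (j * s)) = (if N dvd s then of_nat N else 0)"
    using root_of_unity_power_sum by blast
  define V where "V j = (\<Sum>a\<le>k. const (\<omega> ^ (j * a)) * Y a)" for j
  \<comment> \<open>Inverse discrete Fourier transform: it makes the sum of \<open>\<omega>\<^sup>j V\<^sub>j\<^sup>2 W\<^sub>j\<close> equal to \<open>H\<close>.\<close>
  define W where "W j = (\<Sum>m\<le>2 * k. const (\<omega> ^ (j * (N - 1 - m)) / N) * U m)" for j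
  define G where "G t = (\<Sum>j<N. const (\<omega> ^ j / (3 * t)) * (V j + const t * W j) ^ 3)" for t
  define B where "B = (\<Sum>j<N. const (\<omega> ^ j) * (V j * W j ^ 2))"
  define C where "C = (\<Sum>j<N. const (\<omega> ^ j / 3) * W j ^ 3)"
  have V: "V j \<in> forms n 1" and W: "W j \<in> forms n 1" for j
    unfolding V_def W_def by (intro forms_sum forms_const_mult Y U; simp)+
  have VVV: "(\<Sum>j<N. const (\<omega> ^ j) * V j ^ 3) = 0"
  proof -
    have "(\<Sum>j<N. const (\<omega> ^ j) * V j ^ 3) = (\<Sum>a\<le>k. \<Sum>b\<le>k. \<Sum>c\<le>k.
      const (\<Sum>j<N. \<omega> ^ j * (\<omega> ^ (j * a) * \<omega> ^ (j * b) * \<omega> ^ (j * c))) * (Y a * Y b * Y c))"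
      unfolding power3_eq_cube V_def by (rule const_trilinear_sum)
    also have "\<dots> = 0"
    proof (intro sum.neutral ballI)
      fix a b c assume "a \<in> {..k}" "b \<in> {..k}" "c \<in> {..k}"
      \<comment> \<open>The exponent lies between 1 and \<open>3 * k + 1\<close>, just below
        \<open>N\<close>.\<close>
      then have "\<not> N dvd 1 + a + b + c"
        by (auto simp: N_def dest!: dvd_imp_le)
      moreover have "(\<Sum>j<N. \<omega> ^ j * (\<omega> ^ (j * a) * \<omega> ^ (j * b) * \<omega> ^ (j * c))) =
          (\<Sum>j<N. \<omega> ^ (j * (1 + a + b + c)))"
        by (simp add: power_add distrib_left mult_ac)
      ultimately show "const (\<Sum>j<N. \<omega> ^ j * (\<omega> ^ (j * a) * \<omega> ^ (j * b) * \<omega> ^ (j * c))) *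
          (Y a * Y b * Y c) = 0"
        unfolding \<omega> by simp
    qed
    finally show ?thesis .
  qed
  have VVW: "(\<Sum>j<N. const (\<omega> ^ j) * (V j * V j * W j)) = H"
  proof -
    have "(\<Sum>j<N. const (\<omega> ^ j) * (V j * V j * W j)) = (\<Sum>a\<le>k. \<Sum>b\<le>k. \<Sum>m\<le>2 * k.
      const (\<Sum>j<N. \<omega> ^ j * (\<omega> ^ (j * a) * \<omega> ^ (j * b) * (\<omega> ^ (j * (N - 1 - m)) / N))) *
        (Y a * Y b * U m))"
      unfolding V_def W_def by (rule const_trilinear_sum)
    also have "\<dots> = (\<Sum>a\<le>k. \<Sum>b\<le>k. \<Sum>m\<le>2 * k. if m = a + b then Y a * Y b * U m else 0)"
    proof (intro sum.cong refl)
      fix a b m assume "a \<in> {..k}" "b \<in> {..k}" "m \<in> {..2 * k}"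
      \<comment> \<open>Both \<open>a + b\<close> and \<open>m\<close> are at most
        \<open>2 * k < N\<close>, so the exponent lies strictly between 0 and \<open>2 * N\<close>;
        the only multiple of \<open>N\<close> there is \<open>N\<close>.\<close>
      then have "N dvd a + b + (N - m) \<longleftrightarrow> m = a + b"
      proof -
        have *: "a \<le> k" "b \<le> k" "m \<le> 2 * k"
          using \<open>a \<in> {..k}\<close> \<open>b \<in> {..k}\<close> \<open>m \<in> {..2 * k}\<close> by auto
        have "m = a + b" if "N dvd a + b + (N - m)"
        proof -
          from that obtain q where q: "a + b + (N - m) = N * q" by blast
          have "N - m \<noteq> 0" using * by (simp add: N_def)
          with q have "q \<noteq> 0" by (metis add_is_0 mult_0_right)
          moreover have "N * q < N * 2" unfolding q[symmetric] using * by (simp add: N_def)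
          ultimately have "q = 1" by simp
          with q * show ?thesis by (simp add: N_def)
        qed
        moreover have "a + b + (N - m) = N" if "m = a + b"
          using that * by (simp add: N_def)
        ultimately show ?thesis by auto
      qed
      moreover have "(\<Sum>j<N. \<omega> ^ j * (\<omega> ^ (j * a) * \<omega> ^ (j * b) * (\<omega> ^ (j * (N - 1 - m)) / N))) =
          (\<Sum>j<N. \<omega> ^ (j * (a + b + (N - m)))) / N"
      proof -
        \<comment> \<open>The outer factor \<open>\<omega> ^ j\<close> supplies the 1 by which
          \<open>N - 1 - m\<close> falls short of \<open>N - m\<close>.\<close>
        have *: "a + b + (N - m) = 1 + a + b + (N - 1 - m)"
          using \<open>m \<in> {..2 * k}\<close> by (simp add: N_def)
        show ?thesis
          unfolding * by (simp only: power_add distrib_left sum_divide_distrib) (simp add: mult_ac)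
      qed
      ultimately show "const (\<Sum>j<N. \<omega> ^ j *
          (\<omega> ^ (j * a) * \<omega> ^ (j * b) * (\<omega> ^ (j * (N - 1 - m)) / N))) * (Y a * Y b * U m) =
          (if m = a + b then Y a * Y b * U m else 0)"
        using \<open>N > 0\<close> unfolding \<omega> by simp
    qed
    also have "\<dots> = H"
      unfolding H_def by (intro sum.cong refl) auto
    finally show ?thesis .
  qed
  \<comment> \<open>In the expansion by powers of \<open>t\<close>, the coefficient of
    \<open>1 / (3 * t)\<close> vanishes by \<open>VVV\<close> and the constant term is
    \<open>H\<close> by \<open>VVW\<close>.\<close>
  have G: "G t = H + const t * B + const (t ^ 2) * C" if "t \<noteq> 0" for t
  proof -
    have "const (\<omega> ^ j / (3 * t)) * (V j + const t * W j) ^ 3 =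
        const (1 / (3 * t)) * (const (\<omega> ^ j) * V j ^ 3) + const (\<omega> ^ j) * (V j * V j * W j) +
        const t * (const (\<omega> ^ j) * (V j * W j ^ 2)) +
        const (t ^ 2) * (const (\<omega> ^ j / 3) * W j ^ 3)" for j
    proof -
      define c :: "nat cpoly" where "c = const (\<omega> ^ j / (3 * t))"
      define T :: "nat cpoly" where "T = const t"
      have 3: "(3 :: nat cpoly) = const 3" by (simp add: const_def)
      have "const (\<omega> ^ j) = 3 * T * c" "const (\<omega> ^ j / 3) = T * c" "const (t ^ 2) = T ^ 2"
        "const (1 / (3 * t)) * (const (\<omega> ^ j) * V j ^ 3) = c * V j ^ 3"
        using that unfolding c_def T_def 3
        by (simp_all flip: const_mult const_power add: const_mult_const)
      then show ?thesis
        unfolding c_def[symmetric] T_def[symmetric]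
        by (simp add: algebra_simps power2_eq_square power3_eq_cube)
    qed
    then have "G t = const (1 / (3 * t)) * (\<Sum>j<N. const (\<omega> ^ j) * V j ^ 3) +
        (\<Sum>j<N. const (\<omega> ^ j) * (V j * V j * W j)) + const t * B + const (t ^ 2) * C"
      unfolding G_def B_def C_def by (simp only: sum.distrib sum_distrib_left)
    then show ?thesis
      unfolding VVV VVW by simp
  qed
  show ?thesis
  proof (rule secant_variety_limit[where G = G and \<F> = "at 0"])
    show "H \<in> forms n 3"
      unfolding H_def using forms_mult[OF forms_mult[OF Y Y] U]
      by (intro forms_sum) (simp add: numeral_3_eq_3)
    show "((\<lambda>t. Poly_Mapping.lookup (G t) m) \<longlongrightarrow> Poly_Mapping.lookup H m) (at 0)" for m
    proof (rule Lim_transform_eventually)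
      show "((\<lambda>t. Poly_Mapping.lookup H m + t * Poly_Mapping.lookup B m +
          t ^ 2 * Poly_Mapping.lookup C m) \<longlongrightarrow> Poly_Mapping.lookup H m) (at 0)"
        by (auto intro!: tendsto_eq_intros)
      show "eventually (\<lambda>t. Poly_Mapping.lookup H m + t * Poly_Mapping.lookup B m +
          t ^ 2 * Poly_Mapping.lookup C m = Poly_Mapping.lookup (G t) m) (at 0)"
        unfolding eventually_at_filter by (simp add: G lookup_add)
    qed
    show "eventually (\<lambda>t. G t \<noteq> 0 \<longrightarrow> proj_class (G t) \<in> secant_variety n 3 N) (at 0)"
      unfolding G_def
      by (intro always_eventually allI impI sum_powers_in_secant_variety)
        (auto intro!: forms_add forms_const_mult V[unfolded One_nat_def] W[unfolded One_nat_def])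
  qed (use \<open>H \<noteq> 0\<close> in auto)
qed

subsection \<open>Catalecticant minors\<close>

definition mon3 :: "nat \<Rightarrow> nat \<Rightarrow> nat \<Rightarrow> nat \<Rightarrow>\<^sub>0 nat" where
  "mon3 a b c = Poly_Mapping.single a 1 + Poly_Mapping.single b 1 + Poly_Mapping.single c 1"

lemma lookup_var3:
  "Poly_Mapping.lookup (var a * var b * var c) m = (if mon3 a b c = m then 1 else 0)"
  by (simp add: var_def mon3_def mult_single lookup_single when_def)

text \<open>Comparing the exponents at \<open>a\<close>, \<open>b\<close> and \<open>c\<close>
  already determines how the indices match.\<close>

lemma mon3_eq_iff:
  "mon3 a b c = mon3 d e f \<longleftrightarrow>
    a = d \<and> (b = e \<and> c = f \<or> b = f \<and> c = e) \<or>
    a = e \<and> (b = d \<and> c = f \<or> b = f \<and> c = d) \<or>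
    a = f \<and> (b = d \<and> c = e \<or> b = e \<and> c = d)" (is "?l \<longleftrightarrow> ?r")
proof
  assume ?l
  then have "Poly_Mapping.lookup (mon3 a b c) x = Poly_Mapping.lookup (mon3 d e f) x" for x
    by simp
  from this[of a] this[of b] this[of c] show ?r
    by (auto simp: mon3_def lookup_add lookup_single when_def split: if_splits)
qed (auto simp: mon3_def ac_simps)

text \<open>For a cubic monomial \<open>m\<close> in \<open>x\<^sub>0, \<dots>, x\<^sub>n\<close> this is its multinomial coefficient.\<close>

definition ordered_factorizations :: "nat \<Rightarrow> (nat \<Rightarrow>\<^sub>0 nat) \<Rightarrow> nat" where
  "ordered_factorizations n m =
    card {(a, b, c). a \<le> n \<and> b \<le> n \<and> c \<le> n \<and> mon3 a b c = m}"

lemma finite_ordered_factorizations: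
  "finite {(a, b, c). a \<le> n \<and> b \<le> n \<and> c \<le> n \<and> mon3 a b c = m}"
  by (rule finite_subset[of _ "{..n} \<times> {..n} \<times> {..n}"]) auto

lemma ordered_factorizations_neq_0:
  "a \<le> n \<Longrightarrow> b \<le> n \<Longrightarrow> c \<le> n \<Longrightarrow> ordered_factorizations n (mon3 a b c) \<noteq> 0"
  unfolding ordered_factorizations_def
  using finite_ordered_factorizations[of n "mon3 a b c"] by (auto simp: card_eq_0_iff)

text \<open>All ordered triples with the same product contribute the same value, the monomial
  evaluated at \<open>l\<close>.\<close>

lemma lookup_cube:
  assumes "L = (\<Sum>v\<le>n. const (l v) * var v)"
  shows "Poly_Mapping.lookup (L ^ 3) (mon3 v p q) =
    of_nat (ordered_factorizations n (mon3 v p q)) * (l v * (l p * l q))"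
proof -
  let ?m = "mon3 v p q" and ?S = "{..n} \<times> {..n} \<times> {..n}"
  have mv: "mon_val l (mon3 a b c) = l a * (l b * l c)" for a b c
    by (simp add: mon3_def mon_val_add)
  have "L ^ 3 = (\<Sum>a\<le>n. \<Sum>b\<le>n. \<Sum>c\<le>n. const (l a * l b * l c) * (var a * var b * var c))"
    using const_trilinear_sum[of "\<lambda>_. 1" "\<lambda>_. l" var "{..n}" "\<lambda>_. l" var "{..n}" "\<lambda>_. l" var "{..n}" "{0::nat}"]
    by (simp add: power3_eq_cube assms)
  then have "Poly_Mapping.lookup (L ^ 3) ?m =
      (\<Sum>a\<le>n. \<Sum>b\<le>n. \<Sum>c\<le>n. if mon3 a b c = ?m then l a * l b * l c else 0)"
    by (simp add: lookup_sum lookup_var3 if_distrib cong: if_cong)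
  also have "\<dots> = (\<Sum>(a, b, c)\<in>?S. if mon3 a b c = ?m then mon_val l ?m else 0)"
    unfolding sum.cartesian_product
    by (intro sum.cong refl) (auto simp: mv mult.assoc simp flip: mv)
  also have "\<dots> = (\<Sum>x\<in>{(a, b, c). a \<le> n \<and> b \<le> n \<and> c \<le> n \<and> mon3 a b c = ?m}. mon_val l ?m)"
    by (rule sum.mono_neutral_cong_right) (auto split: if_splits)
  also have "\<dots> = of_nat (ordered_factorizations n ?m) * (l v * (l p * l q))"
    by (simp add: ordered_factorizations_def mv)
  finally show ?thesis .
qed

text \<open>Dividing by the multinomial coefficients turns a cube \<open>L\<^sup>3\<close> into a matrix of rank at most
  one. The columns are indexed by the quadratic monomials \<open>x\<^bsub>p w\<^esub> x\<^bsub>q w\<^esub>\<close>.\<close>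

definition catalecticant_minor ::
    "nat \<Rightarrow> (nat \<Rightarrow> nat) \<Rightarrow> (nat \<Rightarrow> nat) \<Rightarrow> nat cpoly \<Rightarrow> complex mat" where
  "catalecticant_minor n p q G = mat (n + 1) (n + 1) (\<lambda>(v, w).
    Poly_Mapping.lookup G (mon3 v (p w) (q w)) / of_nat (ordered_factorizations n (mon3 v (p w) (q w))))"

text \<open>The Leibniz expansion of the determinant of \<open>catalecticant_minor\<close>, written
  as a polynomial in the coefficients of the form, as \<open>zariski_closed\<close> demands.\<close>

definition catalecticant_poly ::
    "nat \<Rightarrow> (nat \<Rightarrow> nat) \<Rightarrow> (nat \<Rightarrow> nat) \<Rightarrow> (nat \<Rightarrow>\<^sub>0 nat) cpoly" where
  "catalecticant_poly n p q = (\<Sum>\<pi> | \<pi> permutes {0..<n + 1}. const (signof \<pi>) *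
    (\<Prod>v = 0..<n + 1. const (1 / of_nat (ordered_factorizations n (mon3 v (p (\<pi> v)) (q (\<pi> v))))) *
      var (mon3 v (p (\<pi> v)) (q (\<pi> v)))))"

lemma homogeneous_catalecticant_poly: "homogeneous (n + 1) (catalecticant_poly n p q)"
proof -
  have *: "homogeneous 1 (const c * var i)" for c i
    using homogeneous_mult[OF homogeneous_const homogeneous_var, of c i] by simp
  have "homogeneous (0 + card {0..<n + 1}) (const c *
    (\<Prod>v = 0..<n + 1. const (f v) * var (g v)))" for c f g
    by (intro homogeneous_mult homogeneous_const homogeneous_prod *) simp
  then show ?thesis
    unfolding catalecticant_poly_def by (intro homogeneous_sum) simp
qed

lemma eval_catalecticant_poly:
  "eval_poly (Poly_Mapping.lookup G) (catalecticant_poly n p q) = det (catalecticant_minor n p q G)"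
proof -
  have "det (catalecticant_minor n p q G) = (\<Sum>\<pi> | \<pi> permutes {0..<n + 1}. signof \<pi> *
      (\<Prod>v = 0..<n + 1. catalecticant_minor n p q G $$ (v, \<pi> v)))"
    by (rule det_def') (simp add: catalecticant_minor_def)
  also have "\<dots> = eval_poly (Poly_Mapping.lookup G) (catalecticant_poly n p q)"
    unfolding catalecticant_poly_def eval_poly_sum eval_poly_mult eval_poly_prod eval_poly_const
      eval_poly_var
  proof (intro sum.cong prod.cong refl arg_cong2[of _ _ _ _ "(*)"])
    fix \<pi> v assume "\<pi> \<in> {\<pi>. \<pi> permutes {0..<n + 1}}" "v \<in> {0..<n + 1}"
    then have "\<pi> v < n + 1" "v < n + 1"
      using permutes_in_image[of \<pi> "{0..<n + 1}" v] by auto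
    then show "catalecticant_minor n p q G $$ (v, \<pi> v) =
        1 / of_nat (ordered_factorizations n (mon3 v (p (\<pi> v)) (q (\<pi> v)))) *
        Poly_Mapping.lookup G (mon3 v (p (\<pi> v)) (q (\<pi> v)))"
      by (simp add: catalecticant_minor_def)
  qed
  finally show ?thesis by simp
qed

text \<open>The matrix factors through dimension \<open>r\<close>. Padding both factors with zeros
  makes them square, and row \<open>r\<close> of \<open>B'\<close> is then a zero row.\<close>

lemma det_low_rank:
  fixes A :: "nat \<Rightarrow> nat \<Rightarrow> complex"
  assumes "r < N"
  shows "det (mat N N (\<lambda>(v, w). \<Sum>i<r. A v i * B i w)) = 0"
proof -
  define A' where "A' = mat N N (\<lambda>(v, i). if i < r then A v i else 0)"
  define B' where "B' = mat N N (\<lambda>(i, w). if i < r then B i w else 0)"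
  have car: "A' \<in> carrier_mat N N" "B' \<in> carrier_mat N N"
    by (simp_all add: A'_def B'_def)
  have "mat N N (\<lambda>(v, w). \<Sum>i<r. A v i * B i w) = A' * B'"
  proof (rule eq_matI)
    fix v w assume "v < dim_row (A' * B')" "w < dim_col (A' * B')"
    then have vw: "v < N" "w < N" by (simp_all add: A'_def B'_def)
    have "(A' * B') $$ (v, w) = (\<Sum>i<N. if i < r then A v i * B i w else 0)"
      using vw by (auto simp: A'_def B'_def scalar_prod_def lessThan_atLeast0 intro!: sum.cong)
    also have "\<dots> = (\<Sum>i<r. A v i * B i w)"
      using \<open>r < N\<close> by (intro sum.mono_neutral_cong_right) auto
    finally show "mat N N (\<lambda>(v, w). \<Sum>i<r. A v i * B i w) $$ (v, w) = (A' * B') $$ (v, w)"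
      using vw by simp
  qed (simp_all add: A'_def B'_def)
  moreover have "det B' = 0"
    unfolding det_def'[OF car(2)]
  proof (intro sum.neutral ballI)
    fix \<pi> assume "\<pi> \<in> {\<pi>. \<pi> permutes {0..<N}}"
    then have "\<pi> r < N"
      using permutes_in_image[of \<pi> "{0..<N}" r] assms by auto
    then have "B' $$ (r, \<pi> r) = 0"
      using assms by (simp add: B'_def)
    then have "(\<Prod>i = 0..<N. B' $$ (i, \<pi> i)) = 0"
      using assms by (intro prod_zero) auto
    then show "signof \<pi> * (\<Prod>i = 0..<N. B' $$ (i, \<pi> i)) = 0" by simp
  qed
  ultimately show ?thesis
    using det_mult[OF car] by simp
qed

text \<open>Each cube contributes a column vector times a row vector, so at most \<open>n\<close> of
  them cannot give full rank \<open>n + 1\<close>.\<close>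

lemma det_catalecticant_minor_sum_cubes:
  assumes "r \<le> n" and L: "\<And>i. i < r \<Longrightarrow> L i \<in> forms n 1"
    and pq: "\<And>w. w \<le> n \<Longrightarrow> p w \<le> n \<and> q w \<le> n"
  shows "det (catalecticant_minor n p q (\<Sum>i<r. const (a i) * L i ^ 3)) = 0"
proof -
  have "\<exists>l. L i = (\<Sum>v\<le>n. const (l v) * var v)" if "i < r" for i
    using linear_form_expand[OF L[OF that]] by metis
  then obtain l where l: "\<And>i. i < r \<Longrightarrow> L i = (\<Sum>v\<le>n. const (l i v) * var v)"
    by metis
  have "catalecticant_minor n p q (\<Sum>i<r. const (a i) * L i ^ 3) =
      mat (n + 1) (n + 1) (\<lambda>(v, w). \<Sum>i<r. (a i * l i v) * (l i (p w) * l i (q w)))"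
    unfolding catalecticant_minor_def
  proof (rule cong_mat[OF refl refl], clarsimp)
    fix v w assume "v < Suc n" "w < Suc n"
    then have "ordered_factorizations n (mon3 v (p w) (q w)) \<noteq> 0"
      using pq[of w] by (intro ordered_factorizations_neq_0) auto
    then show "Poly_Mapping.lookup (\<Sum>i<r. const (a i) * L i ^ 3) (mon3 v (p w) (q w)) /
        of_nat (ordered_factorizations n (mon3 v (p w) (q w))) =
        (\<Sum>i<r. (a i * l i v) * (l i (p w) * l i (q w)))"
      by (simp add: lookup_sum lookup_cube[OF l] sum_divide_distrib mult_ac)
  qed
  also have "det \<dots> = 0"
    by (rule det_low_rank) (use \<open>r \<le> n\<close> in simp)
  finally show ?thesis .
qed

text \<open>The hypersurface where the minor vanishes is closed and contains all the spans, hence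
  their hull; at \<open>F\<close> the minor is diagonal with nonzero diagonal.\<close>

lemma not_in_secant_variety_cubes:
  assumes "r \<le> n" and pq: "\<And>w. w \<le> n \<Longrightarrow> p w \<le> n \<and> q w \<le> n"
    and off_diag: "\<And>v w. v \<le> n \<Longrightarrow> w \<le> n \<Longrightarrow> v \<noteq> w \<Longrightarrow> Poly_Mapping.lookup F (mon3 v (p w) (q w)) = 0"
    and diag: "\<And>v. v \<le> n \<Longrightarrow> Poly_Mapping.lookup F (mon3 v (p v) (q v)) \<noteq> 0"
  shows "proj_class F \<notin> secant_variety n 3 r"
proof
  let ?P = "catalecticant_poly n p q"
  define Z where "Z = {proj_class G | G. G \<in> forms n 3 \<and> G \<noteq> 0 \<and>
    (\<forall>P\<in>{?P}. eval_poly (Poly_Mapping.lookup G) P = 0)}"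
  have homog: "\<forall>P\<in>{?P}. \<exists>e. homogeneous e P"
    by (intro ballI exI[of _ "n + 1"]) (simp add: homogeneous_catalecticant_poly del: One_nat_def)
  assume "proj_class F \<in> secant_variety n 3 r"
  moreover have "secant_variety n 3 r \<subseteq> Z"
    unfolding secant_variety_def
  proof (rule hull_minimal)
    show "zariski_closed n 3 Z"
      unfolding zariski_closed_def Z_def
      by (rule exI[of _ "{?P}"]) (use homog in simp)
    show "(\<Union>pt\<in>{pt. \<forall>i<r. pt i \<in> veronese n 3}. proj_span r pt) \<subseteq> Z"
    proof clarify
      fix X pt assume pt: "\<forall>i<r. pt i \<in> veronese n 3" and "X \<in> proj_span r pt"
      then obtain a G where X: "X = proj_class (\<Sum>i<r. const (a i) * G i)"
        and G: "\<forall>i<r. G i \<in> pt i" and nz: "(\<Sum>i<r. const (a i) * G i) \<noteq> 0"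
        unfolding proj_span_def by auto
      \<comment> \<open>The span allows any representatives of its points; their scalars are
        absorbed into the coefficients below.\<close>
      have "\<exists>c L. L \<in> forms n 1 \<and> G i = const c * L ^ 3" if "i < r" for i
      proof -
        from pt that obtain L where "L \<in> forms n 1" "pt i = proj_class (L ^ 3)"
          unfolding veronese_def by blast
        moreover have "G i \<in> pt i" using G that by blast
        then obtain c where "G i = const c * L ^ 3"
          unfolding \<open>pt i = proj_class (L ^ 3)\<close> proj_class_def by blast
        ultimately show ?thesis by blast
      qed
      then obtain c L where L: "\<And>i. i < r \<Longrightarrow> L i \<in> forms n 1"
        and cL: "\<And>i. i < r \<Longrightarrow> G i = const (c i) * L i ^ 3" by metis
      have eq: "(\<Sum>i<r. const (a i) * G i) = (\<Sum>i<r. const (a i * c i) * L i ^ 3)"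
        by (intro sum.cong refl) (simp add: cL const_mult_const)
      have "(\<Sum>i<r. const (a i) * G i) \<in> forms n 3"
        unfolding eq by (intro forms_sum forms_const_mult forms_power L) simp
      moreover have "eval_poly (Poly_Mapping.lookup (\<Sum>i<r. const (a i) * G i)) ?P = 0"
        unfolding eval_catalecticant_poly eq
        by (rule det_catalecticant_minor_sum_cubes[OF \<open>r \<le> n\<close> L pq])
      ultimately show "X \<in> Z"
        unfolding X Z_def mem_Collect_eq using nz by (intro exI conjI refl ballI) simp_all
    qed
  qed
  ultimately have "proj_class F \<in> Z" by blast
  then have "eval_poly (Poly_Mapping.lookup F) ?P = 0"
    unfolding Z_def
    by (rule vanishes_on_proj_class[OF homog]) simp
  then have det0: "det (catalecticant_minor n p q F) = 0"
    unfolding eval_catalecticant_poly .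
  have det_diag: "det (catalecticant_minor n p q F) = prod_list (diag_mat (catalecticant_minor n p q F))"
    by (rule det_upper_triangular[of _ "n + 1"])
      (simp_all add: catalecticant_minor_def upper_triangular_def off_diag)
  have "ordered_factorizations n (mon3 v (p v) (q v)) \<noteq> 0" if "v \<le> n" for v
    using that pq[OF that] by (intro ordered_factorizations_neq_0) auto
  then have nz: "catalecticant_minor n p q F $$ (v, v) \<noteq> 0" if "v \<le> n" for v
    using diag[OF that] that by (simp add: catalecticant_minor_def)
  have dim: "dim_row (catalecticant_minor n p q F) = n + 1"
    by (simp add: catalecticant_minor_def)
  have "prod_list (diag_mat (catalecticant_minor n p q F)) \<noteq> 0"
    by (auto simp: prod_list_zero_iff diag_mat_def less_Suc_eq_le dim nz)
  with det0 det_diag show False by simp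
qed

subsection \<open>The chain cubic\<close>

lemma two_times_const_half: "2 * (const (1 / 2) * P) = P"
proof -
  have "(2 :: 'a cpoly) = const 2" by (simp add: const_def)
  then show ?thesis by (simp only: const_mult_const) simp
qed

text \<open>Equal indices give the first sum. A product of neighbours occurs for
  \<open>(a, b)\<close> and for \<open>(b, a)\<close>, which the factor 1/2 in the odd
  \<open>U\<close> compensates.\<close>

lemma chain_cubic_tridiagonal:
  defines "U \<equiv> \<lambda>m. if even m then var (3 * (m div 2)) else const (1 / 2) * var (3 * (m div 2) + 2)"
  shows "chain_cubic k = (\<Sum>a\<le>k. \<Sum>b\<le>k.
    if b = a \<or> b = a + 1 \<or> a = b + 1 then var (3 * a + 1) * var (3 * b + 1) * U (a + b) else 0)"
proof -
  define T where "T a b = var (3 * a + 1) * var (3 * b + 1) * U (a + b)" for a b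
  let ?R = "\<lambda>a b. if b = a + 1 then T a b else 0"
  have sym: "T a b = T b a" for a b
    by (simp add: T_def ac_simps)
  have R: "(\<Sum>a\<le>k. \<Sum>b\<le>k. ?R a b) = (\<Sum>a<k. T a (a + 1))"
  proof -
    have "(\<Sum>a\<le>k. \<Sum>b\<le>k. ?R a b) = (\<Sum>a\<le>k. if a + 1 \<le> k then T a (a + 1) else 0)"
      by (intro sum.cong refl) (simp add: sum.delta)
    also have "\<dots> = (\<Sum>a<k. T a (a + 1))"
      by (rule sum.mono_neutral_cong_right) auto
    finally show ?thesis .
  qed
  have "(\<Sum>a\<le>k. \<Sum>b\<le>k. if b = a \<or> b = a + 1 \<or> a = b + 1 then T a b else 0) =
      (\<Sum>a\<le>k. \<Sum>b\<le>k. (if b = a then T a b else 0) + ?R a b + ?R b a)"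
    by (intro sum.cong refl) (auto simp: sym)
  also have "\<dots> = (\<Sum>a\<le>k. T a a) + (\<Sum>a\<le>k. \<Sum>b\<le>k. ?R a b) + (\<Sum>a\<le>k. \<Sum>b\<le>k. ?R b a)"
    by (simp add: sum.distrib sum.delta)
  also have "\<dots> = (\<Sum>a\<le>k. T a a) + (\<Sum>a<k. 2 * T a (a + 1))"
    unfolding sum.swap[of "\<lambda>a b. ?R b a"] R by (simp only: mult_2 sum.distrib add.assoc)
  also have "(\<Sum>a\<le>k. T a a) = (\<Sum>i=0..k. var (3 * i) * var (3 * i + 1) ^ 2)"
    by (simp add: T_def U_def power2_eq_square ac_simps atLeast0AtMost flip: mult_2)
  also have "(\<Sum>a<k. 2 * T a (a + 1)) =
      (\<Sum>i=1..k. var (3 * i - 2) * var (3 * i - 1) * var (3 * i + 1))"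
  proof -
    have "2 * T a (a + 1) = var (3 * Suc a - 2) * var (3 * Suc a - 1) * var (3 * Suc a + 1)" for a
    proof -
      have "T a (a + 1) = var (3 * a + 1) * var (3 * a + 4) * (const (1 / 2) * var (3 * a + 2))"
        by (simp add: T_def U_def add.commute)
      then have "2 * T a (a + 1) =
          var (3 * a + 1) * var (3 * a + 4) * (2 * (const (1 / 2) * var (3 * a + 2)))"
        by (simp only: mult.left_commute mult.assoc)
      moreover have "3 * Suc a - 2 = 3 * a + 1" "3 * Suc a - 1 = 3 * a + 2" "3 * Suc a + 1 = 3 * a + 4"
        by simp_all
      ultimately show ?thesis
        by (simp only: two_times_const_half mult_ac)
    qed
    then show ?thesis
      unfolding One_nat_def sum.atLeast1_atMost_eq by simp
  qed
  finally show ?thesis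
    unfolding chain_cubic_def T_def by simp
qed

text \<open>With \<open>d\<close> the distance of \<open>a\<close> and \<open>b\<close>, the left
  side is half of \<open>(a + b)\<^sup>2 + d\<^sup>2\<close>. The two squares have equal parity, so
  one half may be rounded up and the other down, and \<open>D\<close> is
  \<open>d\<^sup>2 div 2\<close>. It becomes the exponent of \<open>\<epsilon>\<close> left after
  rescaling.\<close>

lemma squares_vs_half_square_of_sum:
  fixes a b :: nat
  obtains D where "a\<^sup>2 + b\<^sup>2 = ((a + b)\<^sup>2 + 1) div 2 + D" "D = 0 \<longleftrightarrow> b = a \<or> b = a + 1 \<or> a = b + 1"
proof -
  have *: "a\<^sup>2 + (a + d)\<^sup>2 = ((a + (a + d))\<^sup>2 + 1) div 2 + d\<^sup>2 div 2" for a d :: nat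
  proof -
    have "(a + (a + d))\<^sup>2 + 1 = 2 * (2 * a\<^sup>2 + 2 * a * d) + (d\<^sup>2 + 1)"
      by (simp add: power2_eq_square algebra_simps)
    moreover have "a\<^sup>2 + (a + d)\<^sup>2 = 2 * a\<^sup>2 + 2 * a * d + d\<^sup>2"
      by (simp add: power2_eq_square algebra_simps)
    moreover have "d\<^sup>2 = (d\<^sup>2 + 1) div 2 + d\<^sup>2 div 2" by presburger
    ultimately show ?thesis by simp
  qed
  have D: "d\<^sup>2 div 2 = 0 \<longleftrightarrow> d \<le> 1" for d :: nat
  proof
    assume "d\<^sup>2 div 2 = 0"
    then have "d\<^sup>2 < 2\<^sup>2" by simp
    then show "d \<le> 1" using power_less_imp_less_base[of d 2 2] by simp
  qed (auto simp: le_Suc_eq)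
  show thesis
  proof (cases "a \<le> b")
    case True
    then obtain d where "b = a + d" using le_Suc_ex by blast
    with *[of a d] D[of d] show thesis by (intro that[of "d\<^sup>2 div 2"]) auto
  next
    case False
    then obtain d where "a = b + d" using le_Suc_ex nat_le_linear by blast
    with *[of b d] D[of d] show thesis by (intro that[of "d\<^sup>2 div 2"]) (auto simp: add_ac)
  qed
qed

lemma chain_cubic_in_secant_variety:
  assumes "chain_cubic k \<noteq> 0"
  shows "proj_class (chain_cubic k) \<in> secant_variety (3 * k + 1) 3 (3 * k + 2)"
proof -
  define n where "n = 3 * k + 1"
  define y :: "nat \<Rightarrow> nat cpoly" where "y a = var (3 * a + 1)" for a
  define U :: "nat \<Rightarrow> nat cpoly" where
    "U m = (if even m then var (3 * (m div 2)) else const (1 / 2) * var (3 * (m div 2) + 2))" for m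
  have y: "y a \<in> forms n 1" if "a \<le> k" for a
    unfolding y_def by (rule forms_var) (use that in \<open>simp add: n_def\<close>)
  have U: "U m \<in> forms n 1" if "m \<le> 2 * k" for m
    unfolding U_def using that by (auto simp: n_def intro!: forms_const_mult forms_var[unfolded One_nat_def] elim!: oddE)
  \<comment> \<open>The preceding lemma shows that this subtraction is not truncated.\<close>
  define D where "D a b = a\<^sup>2 + b\<^sup>2 - ((a + b)\<^sup>2 + 1) div 2" for a b :: nat
  have D: "a\<^sup>2 + b\<^sup>2 = ((a + b)\<^sup>2 + 1) div 2 + D a b"
    "D a b = 0 \<longleftrightarrow> b = a \<or> b = a + 1 \<or> a = b + 1" for a b
    using squares_vs_half_square_of_sum[of a b] by (metis D_def add_diff_cancel_left')+
  define G where "G \<epsilon> = (\<Sum>a\<le>k. \<Sum>b\<le>k. const (\<epsilon> ^ D a b) * (y a * y b * U (a + b)))" for \<epsilon>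
  \<comment> \<open>As \<open>0 ^ 0 = 1\<close>, exactly the terms with \<open>D a b = 0\<close>
    survive.\<close>
  have F: "chain_cubic k = G 0"
    unfolding chain_cubic_tridiagonal G_def U_def[symmetric] y_def[symmetric]
    by (intro sum.cong refl) (auto simp: power_0_left D(2))
  have "proj_class (G 0) \<in> secant_variety n 3 (3 * k + 2)"
  proof (rule secant_variety_limit[where G = G and \<F> = "at 0"])
    show "G 0 \<in> forms n 3"
      unfolding G_def using forms_mult[OF forms_mult[OF y y] U]
      by (intro forms_sum forms_const_mult) (simp add: numeral_3_eq_3)
    show "((\<lambda>\<epsilon>. Poly_Mapping.lookup (G \<epsilon>) m) \<longlongrightarrow> Poly_Mapping.lookup (G 0) m) (at 0)" for m
      unfolding G_def lookup_sum lookup_const_mult by (intro tendsto_intros)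
    have "proj_class (G \<epsilon>) \<in> secant_variety n 3 (3 * k + 2)" if "\<epsilon> \<noteq> 0" "G \<epsilon> \<noteq> 0" for \<epsilon>
    proof -
      \<comment> \<open>For nonzero \<open>\<epsilon>\<close> the powers are absorbed into the
        linear forms, which leaves a sum over all pairs with equal weights.\<close>
      define Y where "Y a = const (\<epsilon> ^ a\<^sup>2) * y a" for a
      define V where "V m = const (1 / \<epsilon> ^ ((m\<^sup>2 + 1) div 2)) * U m" for m
      have *: "G \<epsilon> = (\<Sum>a\<le>k. \<Sum>b\<le>k. Y a * Y b * V (a + b))"
        unfolding G_def
      proof (intro sum.cong refl)
        fix a b
        have "\<epsilon> ^ D a b = \<epsilon> ^ a\<^sup>2 * \<epsilon> ^ b\<^sup>2 * (1 / \<epsilon> ^ (((a + b)\<^sup>2 + 1) div 2))"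
          using \<open>\<epsilon> \<noteq> 0\<close> by (simp only: power_add[symmetric] D(1)) (simp add: power_add)
        then show "const (\<epsilon> ^ D a b) * (y a * y b * U (a + b)) = Y a * Y b * V (a + b)"
          by (simp only: Y_def V_def const_mult mult_ac)
      qed
      show ?thesis
        using that(2) unfolding *
        by (intro rational_normal_curve_in_secant_variety)
          (auto simp: Y_def V_def intro!: forms_const_mult y[unfolded One_nat_def] U[unfolded One_nat_def])
    qed
    then show "eventually (\<lambda>\<epsilon>. G \<epsilon> \<noteq> 0 \<longrightarrow> proj_class (G \<epsilon>) \<in> secant_variety n 3 (3 * k + 2)) (at 0)"
      by (simp add: eventually_at_filter)
  qed (use assms F in auto)
  then show ?thesis by (simp add: F n_def)
qed

section \<open>Coefficients of the cubic and the lower bound\<close>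

lemma lookup_chain_cubic:
  "Poly_Mapping.lookup (chain_cubic k) m =
    of_nat (card {i\<in>{0..k}. mon3 (3 * i) (3 * i + 1) (3 * i + 1) = m} +
      card {i\<in>{1..k}. mon3 (3 * i - 2) (3 * i - 1) (3 * i + 1) = m})"
proof -
  have "Poly_Mapping.lookup (chain_cubic k) m =
      (\<Sum>i=0..k. if mon3 (3 * i) (3 * i + 1) (3 * i + 1) = m then 1 else 0) +
      (\<Sum>i=1..k. if mon3 (3 * i - 2) (3 * i - 1) (3 * i + 1) = m then 1 else 0)"
    unfolding chain_cubic_def power2_eq_square mult.assoc[symmetric]
    by (simp only: lookup_add lookup_sum lookup_var3)
  then show ?thesis
    by (simp flip: sum.inter_filter)
qed

text \<open>Coefficients count terms, so nothing cancels. The second family is shifted by one to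
  remove the subtractions.\<close>

lemma lookup_chain_cubic_eq_0_iff:
  "Poly_Mapping.lookup (chain_cubic k) m = 0 \<longleftrightarrow>
    (\<forall>i\<le>k. mon3 (3 * i) (3 * i + 1) (3 * i + 1) \<noteq> m) \<and>
    (\<forall>i<k. mon3 (3 * i + 1) (3 * i + 2) (3 * i + 4) \<noteq> m)"
proof -
  let ?A = "{i\<in>{0..k}. mon3 (3 * i) (3 * i + 1) (3 * i + 1) = m}"
  let ?B = "{i\<in>{1..k}. mon3 (3 * i - 2) (3 * i - 1) (3 * i + 1) = m}"
  have "Poly_Mapping.lookup (chain_cubic k) m = 0 \<longleftrightarrow> ?A = {} \<and> ?B = {}"
    unfolding lookup_chain_cubic of_nat_eq_0_iff add_is_0 by (subst (1 2) card_0_eq) simp_all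
  also have "?B = Suc ` {i\<in>{..<k}. mon3 (3 * i + 1) (3 * i + 2) (3 * i + 4) = m}"
  proof -
    have "{1..k} = Suc ` {..<k}"
      by (simp add: image_Suc_lessThan)
    then have "?B = Suc ` {i\<in>{..<k}. mon3 (3 * Suc i - 2) (3 * Suc i - 1) (3 * Suc i + 1) = m}"
      by auto
    moreover have "3 * Suc i - 2 = 3 * i + 1" "3 * Suc i - 1 = 3 * i + 2" "3 * Suc i + 1 = 3 * i + 4"
      for i by simp_all
    ultimately show ?thesis by (simp only:)
  qed
  also have "\<dots> = {} \<longleftrightarrow> (\<forall>i<k. mon3 (3 * i + 1) (3 * i + 2) (3 * i + 4) \<noteq> m)"
    unfolding image_is_empty by blast
  also have "?A = {} \<longleftrightarrow> (\<forall>i\<le>k. mon3 (3 * i) (3 * i + 1) (3 * i + 1) \<noteq> m)"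
    by (simp add: Collect_empty_eq)
  finally show ?thesis .
qed

lemma chain_cubic_not_in_secant_variety:
  assumes "r \<le> 3 * k + 1"
  shows "proj_class (chain_cubic k) \<notin> secant_variety (3 * k + 1) 3 r"
proof (rule not_in_secant_variety_cubes[OF assms])
  \<comment> \<open>For each variable a monomial of \<open>chain_cubic k\<close> divisible by it, such that the quotient
    \<open>x\<^bsub>p w\<^esub> x\<^bsub>q w\<^esub>\<close> divides no other monomial: the minor is diagonal.\<close>
  define p where "p w = (if w mod 3 = 0 then w + 1 else w - 1)" for w :: nat
  define q where "q w = (if w mod 3 = 0 then w + 1 else if w mod 3 = 1 then w else w + 2)" for w :: nat
  have w: "\<exists>j\<le>k. w = 3 * j \<and> p w = 3 * j + 1 \<and> q w = 3 * j + 1 \<or>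
      w = 3 * j + 1 \<and> p w = 3 * j \<and> q w = 3 * j + 1 \<or>
      j < k \<and> w = 3 * j + 2 \<and> p w = 3 * j + 1 \<and> q w = 3 * j + 4" if "w \<le> 3 * k + 1" for w
  proof -
    have "w = 3 * (w div 3) \<and> w mod 3 = 0 \<or> w = 3 * (w div 3) + 1 \<and> w mod 3 = 1 \<or>
        w = 3 * (w div 3) + 2 \<and> w mod 3 = 2" by presburger
    with that show ?thesis
      unfolding p_def q_def by (intro exI[of _ "w div 3"]) auto
  qed
  show "p w \<le> 3 * k + 1 \<and> q w \<le> 3 * k + 1" if "w \<le> 3 * k + 1" for w
    using w[OF that] by auto
  show "Poly_Mapping.lookup (chain_cubic k) (mon3 v (p v) (q v)) \<noteq> 0" if v: "v \<le> 3 * k + 1" for v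
  proof -
    have sq: "Poly_Mapping.lookup (chain_cubic k) (mon3 (3 * j) (3 * j + 1) (3 * j + 1)) \<noteq> 0"
      if "j \<le> k" for j
      using that unfolding lookup_chain_cubic_eq_0_iff by blast
    have mixed: "Poly_Mapping.lookup (chain_cubic k) (mon3 (3 * j + 1) (3 * j + 2) (3 * j + 4)) \<noteq> 0"
      if "j < k" for j
      using that unfolding lookup_chain_cubic_eq_0_iff by blast
    from w[OF v] obtain j where "j \<le> k" and
      "v = 3 * j \<and> p v = 3 * j + 1 \<and> q v = 3 * j + 1 \<or>
      v = 3 * j + 1 \<and> p v = 3 * j \<and> q v = 3 * j + 1 \<or>
      j < k \<and> v = 3 * j + 2 \<and> p v = 3 * j + 1 \<and> q v = 3 * j + 4" by blast
    \<comment> \<open>Residues 0 and 1 modulo 3 use different factors of the same monomial.\<close>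
    then have "mon3 v (p v) (q v) = mon3 (3 * j) (3 * j + 1) (3 * j + 1) \<or>
        j < k \<and> mon3 v (p v) (q v) = mon3 (3 * j + 1) (3 * j + 2) (3 * j + 4)"
      by (elim disjE conjE) (simp_all add: mon3_eq_iff)
    then show ?thesis
      using sq[OF \<open>j \<le> k\<close>] mixed[of j] by metis
  qed
  show "Poly_Mapping.lookup (chain_cubic k) (mon3 v (p w) (q w)) = 0"
    if "v \<le> 3 * k + 1" "w \<le> 3 * k + 1" "v \<noteq> w" for v w
  proof -
    from w[OF that(2)] obtain j P Q where PQ: "p w = P" "q w = Q" and j:
      "w = 3 * j \<and> P = 3 * j + 1 \<and> Q = 3 * j + 1 \<or>
      w = 3 * j + 1 \<and> P = 3 * j \<and> Q = 3 * j + 1 \<or>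
      w = 3 * j + 2 \<and> P = 3 * j + 1 \<and> Q = 3 * j + 4" by blast
    \<comment> \<open>Residues modulo 3 show that a match forces \<open>i = j\<close> and leaves
      \<open>w\<close> as the remaining index, against \<open>v \<noteq> w\<close>.\<close>
    have "mon3 (3 * i) (3 * i + 1) (3 * i + 1) \<noteq> mon3 v P Q" for i
    proof
      assume "mon3 (3 * i) (3 * i + 1) (3 * i + 1) = mon3 v P Q"
      then show False
        unfolding mon3_eq_iff using j \<open>v \<noteq> w\<close> by (elim disjE conjE; presburger)
    qed
    moreover have "mon3 (3 * i + 1) (3 * i + 2) (3 * i + 4) \<noteq> mon3 v P Q" for i
    proof
      assume "mon3 (3 * i + 1) (3 * i + 2) (3 * i + 4) = mon3 v P Q"
      then show False
        unfolding mon3_eq_iff using j \<open>v \<noteq> w\<close> by (elim disjE conjE; presburger)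
    qed
    ultimately show ?thesis
      unfolding lookup_chain_cubic_eq_0_iff PQ by blast
  qed
qed

theorem proposition7p5:
  fixes k n :: nat
  assumes "k \<ge> 1" and "n = 3 * k + 1"
  shows "border_rank n 3 (chain_cubic k) = n + 1"
  unfolding border_rank_def
proof (rule Least_equality)
  \<comment> \<open>The monomial with \<open>i = 0\<close> in the first sum witnesses that the cubic
    is nonzero.\<close>
  have "Poly_Mapping.lookup (chain_cubic k) (mon3 (3 * 0) (3 * 0 + 1) (3 * 0 + 1)) \<noteq> 0"
    unfolding lookup_chain_cubic_eq_0_iff by blast
  then have "chain_cubic k \<noteq> 0" by auto
  then show "proj_class (chain_cubic k) \<in> secant_variety n 3 (n + 1)"
    using chain_cubic_in_secant_variety[of k] assms(2) by simp
  show "n + 1 \<le> r" if "proj_class (chain_cubic k) \<in> secant_variety n 3 r" for r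
    using chain_cubic_not_in_secant_variety[of r k] that assms(2) by (cases "r \<le> n") auto
qed

end
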